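(* Let $Y\in\mathcal{L}^2$ be the outcome. An aggregator $\mathcal{X}$ of calibrated predictions $X_1,\dots,X_N$ of $Y$ is efficient (that is, there exists a probability space $(\Omega,\mathcal{F},\mathbb{P})$ under which $\mathcal{X}=\mathbb{E}(Y\mid X_1,\dots,X_N)$ a.s.) if and only if it has the following two properties. (i) $\mathcal{X}$ is calibrated: $\mathbb{E}(Y\mid\mathcal{X})=\mathcal{X}$ a.s. (ii) $\mathcal{X}$ is extremizing: $\operatorname{Var}\left[\mathbb{E}(Y\mid X_j,\ j\in\mathbf{v})\right]\le\operatorname{Var}(\mathcal{X})$ for all subsets $\mathbf{v}\subseteq\{1,\dots,N\}$.
   Context: There are $N\in\mathbb{N}$ forecasters making point predictions $X_1,\dots,X_N$ about a future real-valued outcome $Y$. The predictions and the outcome are random variables defined under a common probability space $(\Omega,\mathcal{F},\mathbb{P})$, and $Y\in\mathcal{L}^2$, where $\mathcal{L}^p$ denotes the $\mathcal{F}$-measurable random variables $Z$ with $\mathbb{E}[|Z|^p]<\infty$. A prediction $X_j$ is calibrated if $X_j=\mathbb{E}(Y\mid X_j)$ a.s.; equivalently, $X_j=\mathbb{E}(Y\mid\mathcal{F}_j)$ a.s. for some information set ($\sigma$-field) $\mathcal{F}_j\subseteq\mathcal{F}$. An aggregator is any prediction that is measurable with respect to $\mathcal{F}'':=\sigma(X_1,\dots,X_N)$, the $\sigma$-field of all information that can be inferred from the reported predictions. Definition of efficiency: an aggregator $\mathcal{X}$ is efficient if there exists a probability space $(\Omega,\mathcal{F},\mathbb{P})$ under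 which $\mathcal{X}=\mathbb{E}(Y\mid X_1,\dots,X_N)$ a.s. or, equivalently, $\mathcal{X}=\mathbb{E}(Y\mid\mathcal{F}'')$ a.s. Thus efficiency is meant in a weak, existential sense, and an aggregator is inefficient if there is no probability space under which it uses all the information in the predictions. The expression $\mathbb{E}(Y\mid X_j,\ j\in\mathbf{v})$ denotes the conditional expectation of $Y$ given $\sigma(X_j: j\in\mathbf{v})$. *)

theory Defs
  imports "HOL-Probability.Probability"
begin

text \<open>
  A probability space is a measure \<open>M\<close> with \<open>prob_space M\<close>; it carries sample space, \<open>\<sigma>\<close>-field and
  probability at once, so quantifying over \<open>M\<close> quantifies over whole triples.  The predictions
  \<open>X 1, \<dots>, X N\<close>, the outcome \<open>Y\<close> and the aggregator \<open>A\<close> are plain functions, so that the same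
  random variables can be considered under different probability spaces.
\<close>

definition sigma_of :: "'a measure \<Rightarrow> (nat \<Rightarrow> 'a \<Rightarrow> real) \<Rightarrow> nat set \<Rightarrow> 'a measure" where
  "sigma_of M X v =
     sigma (space M) (\<Union>j\<in>v. {X j -` B \<inter> space M | B. B \<in> sets borel})"
  \<comment> \<open>only the sets of the result matter; for \<open>v = {}\<close> it is the trivial \<open>\<sigma>\<close>-field on \<open>space M\<close>\<close>

definition cond_exp_given :: "'a measure \<Rightarrow> (nat \<Rightarrow> 'a \<Rightarrow> real) \<Rightarrow> nat set \<Rightarrow> ('a \<Rightarrow> real) \<Rightarrow> 'a \<Rightarrow> real" where
  "cond_exp_given M X v Y = real_cond_exp M (sigma_of M X v) Y"

definition calibrated :: "'a measure \<Rightarrow> ('a \<Rightarrow> real) \<Rightarrow> ('a \<Rightarrow> real) \<Rightarrow> bool" where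
  "calibrated M Y Z \<longleftrightarrow>
     (AE \<omega> in M. Z \<omega> = real_cond_exp M (vimage_algebra (space M) Z borel) Y \<omega>)"

definition calibrated_predictions :: "'a measure \<Rightarrow> nat \<Rightarrow> (nat \<Rightarrow> 'a \<Rightarrow> real) \<Rightarrow> ('a \<Rightarrow> real) \<Rightarrow> bool" where
  "calibrated_predictions M N X Y \<longleftrightarrow>
     prob_space M \<and>
     Y \<in> borel_measurable M \<and> integrable M (\<lambda>\<omega>. (Y \<omega>)\<^sup>2) \<and>
     (\<forall>j\<in>{1..N}. X j \<in> borel_measurable M \<and> calibrated M Y (X j))"

definition aggregator :: "'a measure \<Rightarrow> nat \<Rightarrow> (nat \<Rightarrow> 'a \<Rightarrow> real) \<Rightarrow> ('a \<Rightarrow> real) \<Rightarrow> bool" where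
  "aggregator M N X A \<longleftrightarrow> A \<in> borel_measurable (sigma_of M X {1..N})"

definition extremizing :: "'a measure \<Rightarrow> nat \<Rightarrow> (nat \<Rightarrow> 'a \<Rightarrow> real) \<Rightarrow> ('a \<Rightarrow> real) \<Rightarrow> ('a \<Rightarrow> real) \<Rightarrow> bool" where
  "extremizing M N X Y A \<longleftrightarrow>
     (\<forall>v. v \<subseteq> {1..N} \<longrightarrow>
        prob_space.variance M (cond_exp_given M X v Y) \<le> prob_space.variance M A)"

definition efficient_under :: "'a measure \<Rightarrow> nat \<Rightarrow> (nat \<Rightarrow> 'a \<Rightarrow> real) \<Rightarrow> ('a \<Rightarrow> real) \<Rightarrow> ('a \<Rightarrow> real) \<Rightarrow> bool" where
  "efficient_under M N X Y A \<longleftrightarrow> (AE \<omega> in M. A \<omega> = cond_exp_given M X {1..N} Y \<omega>)"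

text \<open>
  Efficiency is existential in the probability space.  The standing assumptions (square-integrable
  outcome, calibrated predictions, measurability of the aggregator in the reported information) are
  about a probability space as well, and are imposed on the one that is asserted to exist.
\<close>

definition efficient :: "nat \<Rightarrow> (nat \<Rightarrow> 'a \<Rightarrow> real) \<Rightarrow> ('a \<Rightarrow> real) \<Rightarrow> ('a \<Rightarrow> real) \<Rightarrow> bool" where
  "efficient N X Y A \<longleftrightarrow>
     (\<exists>M. calibrated_predictions M N X Y \<and> aggregator M N X A \<and> efficient_under M N X Y A)"

end

theory Submission
  imports Defs
begin

text \<open>
  Write \<open>Z = E(Y | X\<^sub>1, \<dots>, X\<^sub>N)\<close>.  Conditional expectation is an orthogonal projection in \<open>L\<^sup>2\<close>, so
  \<open>E((Z - E(Z | G))\<^sup>2) = Var Z - Var (E(Z | G))\<close> for every \<open>\<sigma>\<close>-field \<open>G\<close>.  If \<open>A = Z\<close> a.s., the tower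
  property gives calibration, and nonnegativity of the left-hand side gives extremization.  Conversely,
  a calibrated aggregator satisfies \<open>A = E(Z | A)\<close>, and the inequality \<open>Var Z \<le> Var A\<close>, which is
  extremization for \<open>v = {1, \<dots>, N}\<close>, forces \<open>E((Z - A)\<^sup>2) \<le> 0\<close>.
\<close>

lemma space_sigma_of [simp]: "space (sigma_of M X v) = space M"
  by (auto simp: sigma_of_def space_measure_of_conv)

lemma sets_sigma_of:
  "sets (sigma_of M X v) =
     sigma_sets (space M) (\<Union>j\<in>v. {X j -` B \<inter> space M | B. B \<in> sets borel})"
  unfolding sigma_of_def by (rule sets_measure_of) auto

lemma subalgebra_sigma_of:
  assumes "\<And>j. j \<in> v \<Longrightarrow> X j \<in> borel_measurable M"
  shows "subalgebra M (sigma_of M X v)"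
  unfolding subalgebra_def sets_sigma_of
  using assms by (auto intro!: sets.sigma_sets_subset measurable_sets)

lemma subalgebra_sigma_of_mono:
  assumes "v \<subseteq> w"
  shows "subalgebra (sigma_of M X w) (sigma_of M X v)"
  using assms unfolding subalgebra_def sets_sigma_of
  by (auto intro!: sigma_sets_mono')

lemma subalgebra_vimage_algebra:
  assumes "f \<in> borel_measurable M"
  shows "subalgebra M (vimage_algebra (space M) f borel)"
  unfolding subalgebra_def sets_vimage_algebra
  using assms by (auto intro!: sets.sigma_sets_subset measurable_sets)

lemma subalgebra_trans: "subalgebra M F \<Longrightarrow> subalgebra F G \<Longrightarrow> subalgebra M G"
  by (auto simp: subalgebra_def)

text \<open>A finite measure stays finite, hence \<sigma>-finite, on any sub-\<sigma>-field. This
  opens the locale in which the facts on \<open>real_cond_exp\<close> are stated.\<close>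

lemma (in prob_space) sigma_finite_subalgebraI:
  assumes "subalgebra M G"
  shows "sigma_finite_subalgebra M G"
proof -
  interpret finite_measure_subalgebra M G
    by unfold_locales (rule assms)
  show ?thesis by unfold_locales
qed

text \<open>Conditional Jensen for the convex function \<open>x\<^sup>2\<close>: conditioning does
  not leave \<open>L\<^sup>2\<close>.\<close>

lemma (in prob_space) integrable_power2_real_cond_exp:
  fixes f :: "'a \<Rightarrow> real"
  assumes G: "subalgebra M G"
    and [measurable]: "f \<in> borel_measurable M" and sq: "integrable M (\<lambda>x. (f x)\<^sup>2)"
  shows "integrable M (\<lambda>x. (real_cond_exp M G f x)\<^sup>2)"
proof -
  interpret sigma_finite_subalgebra M G by (rule sigma_finite_subalgebraI[OF G])
  show ?thesis
    by (rule integrable_convex_cond_exp[where I = UNIV and X = f])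
      (use sq square_integrable_imp_integrable[OF _ sq] in \<open>auto simp: convex_power2\<close>)
qed

text \<open>Pythagoras: the residual is orthogonal to the projection, so its squared norm is a
  difference of second moments. Since \<open>f\<close> and its projection have the same mean, this
  is also the difference of the variances.\<close>

lemma (in prob_space) residual_real_cond_exp:
  fixes f :: "'a \<Rightarrow> real"
  assumes G: "subalgebra M G"
    and f [measurable]: "f \<in> borel_measurable M" and sq: "integrable M (\<lambda>x. (f x)\<^sup>2)"
  shows "integrable M (\<lambda>x. (f x - real_cond_exp M G f x)\<^sup>2)"
    and "expectation (\<lambda>x. (f x - real_cond_exp M G f x)\<^sup>2) =
           variance f - variance (real_cond_exp M G f)"
proof -
  interpret sigma_finite_subalgebra M G by (rule sigma_finite_subalgebraI[OF G])
  let ?g = "real_cond_exp M G f"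
  note sqg = integrable_power2_real_cond_exp[OF G f sq]
  have int: "integrable M f" by (rule square_integrable_imp_integrable[OF _ sq]) simp
  have intg: "integrable M ?g" using real_cond_exp_int(1)[OF int] .
  have prod: "integrable M (\<lambda>x. ?g x * f x)"
  proof (rule Bochner_Integration.integrable_bound[OF Bochner_Integration.integrable_add[OF sqg sq]])
    have "\<bar>a * b\<bar> \<le> a\<^sup>2 + b\<^sup>2" for a b :: real
    proof -
      have "0 \<le> (\<bar>a\<bar> - \<bar>b\<bar>)\<^sup>2" by simp
      then have "2 * \<bar>a * b\<bar> \<le> a\<^sup>2 + b\<^sup>2" by (simp add: power2_diff abs_mult)
      then show ?thesis by linarith
    qed
    then show "AE x in M. norm (?g x * f x) \<le> norm ((?g x)\<^sup>2 + (f x)\<^sup>2)" by simp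
  qed simp
  \<comment> \<open>\<open>?g\<close> is measurable with respect to \<open>G\<close>, so
    \<open>f\<close> may be replaced by \<open>?g\<close> in the product under the integral.\<close>
  have orth: "expectation (\<lambda>x. ?g x * f x) = expectation (\<lambda>x. (?g x)\<^sup>2)"
    using real_cond_exp_intg(2)[OF prod] by (simp add: power2_eq_square)
  have expand: "(\<lambda>x. (f x - ?g x)\<^sup>2) = (\<lambda>x. (f x)\<^sup>2 + (?g x)\<^sup>2 - 2 * (?g x * f x))"
    by (auto simp: power2_eq_square algebra_simps)
  show "integrable M (\<lambda>x. (f x - ?g x)\<^sup>2)"
    unfolding expand using prod sq sqg by auto
  have "expectation (\<lambda>x. (f x - ?g x)\<^sup>2) = expectation (\<lambda>x. (f x)\<^sup>2) - expectation (\<lambda>x. (?g x)\<^sup>2)"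
    using prod sq sqg by (simp add: expand orth)
  then show "expectation (\<lambda>x. (f x - ?g x)\<^sup>2) = variance f - variance ?g"
    unfolding variance_eq[OF int sq] variance_eq[OF intg sqg]
    by (simp add: real_cond_exp_int(2)[OF int])
qed

lemma (in prob_space) variance_real_cond_exp_le:
  fixes f :: "'a \<Rightarrow> real"
  assumes "subalgebra M G" "f \<in> borel_measurable M" "integrable M (\<lambda>x. (f x)\<^sup>2)"
  shows "variance (real_cond_exp M G f) \<le> variance f"
proof -
  have "0 \<le> expectation (\<lambda>x. (f x - real_cond_exp M G f x)\<^sup>2)" by simp
  then show ?thesis using residual_real_cond_exp(2)[OF assms] by simp
qed

text \<open>The equality case of the variance inequality: the squared residual is nonnegative and
  its integral is zero, so it vanishes almost everywhere.\<close>

lemma (in prob_space) AE_eq_real_cond_exp: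
  fixes f :: "'a \<Rightarrow> real"
  assumes "subalgebra M G" "f \<in> borel_measurable M" "integrable M (\<lambda>x. (f x)\<^sup>2)"
    and "variance f \<le> variance (real_cond_exp M G f)"
  shows "AE x in M. f x = real_cond_exp M G f x"
proof -
  note res = residual_real_cond_exp[OF assms(1-3)]
  have "expectation (\<lambda>x. (f x - real_cond_exp M G f x)\<^sup>2) = 0"
  proof (rule antisym)
    show "expectation (\<lambda>x. (f x - real_cond_exp M G f x)\<^sup>2) \<le> 0"
      unfolding res(2) using assms(4) by simp
  qed simp
  then have "AE x in M. (f x - real_cond_exp M G f x)\<^sup>2 = 0"
    using integral_nonneg_eq_0_iff_AE[OF res(1)] by simp
  then show ?thesis by simp
qed

lemma (in prob_space) variance_cong_AE:
  fixes f g :: "'a \<Rightarrow> real"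
  assumes [measurable]: "f \<in> borel_measurable M" "g \<in> borel_measurable M"
    and eq: "AE x in M. f x = g x"
  shows "variance f = variance g"
proof -
  have "expectation f = expectation g" by (rule integral_cong_AE) (use eq in auto)
  then show ?thesis by (intro integral_cong_AE) (use eq in auto)
qed

text \<open>The equivalence holds on each fixed probability space, which is stronger than the
  existential form.\<close>

lemma efficient_under_iff:
  assumes pred: "calibrated_predictions M N X Y" and agg: "aggregator M N X A"
  shows "efficient_under M N X Y A \<longleftrightarrow> calibrated M Y A \<and> extremizing M N X Y A"
proof -
  interpret prob_space M using pred by (simp add: calibrated_predictions_def)
  have Y [measurable]: "Y \<in> borel_measurable M" and sqY: "integrable M (\<lambda>x. (Y x)\<^sup>2)"
    and X: "\<And>j. j \<in> {1..N} \<Longrightarrow> X j \<in> borel_measurable M"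
    using pred by (auto simp: calibrated_predictions_def)
  have intY: "integrable M Y" by (rule square_integrable_imp_integrable[OF Y sqY])
  define F where "F = sigma_of M X {1..N}"
  define G where "G = vimage_algebra (space M) A borel"
  define Z where "Z = real_cond_exp M F Y"
  have F: "subalgebra M F" unfolding F_def by (rule subalgebra_sigma_of[OF X])
  have AF: "A \<in> borel_measurable F" using agg by (simp add: aggregator_def F_def)
  have [measurable]: "A \<in> borel_measurable M" by (rule measurable_from_subalg[OF F AF])
  \<comment> \<open>This is where the aggregator hypothesis enters: \<open>A\<close> reveals nothing
    beyond the predictions, so the tower property applies to conditioning on
    \<open>A\<close>.\<close>
  have GF: "subalgebra F G"
    using subalgebra_vimage_algebra[OF AF] by (simp add: F_def G_def)
  have G: "subalgebra M G" by (rule subalgebra_trans[OF F GF])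
  have AG: "A \<in> borel_measurable G"
    unfolding G_def by (rule measurable_vimage_algebra1) simp
  have Z [measurable]: "Z \<in> borel_measurable M" by (simp add: Z_def)
  have sqZ: "integrable M (\<lambda>x. (Z x)\<^sup>2)"
    unfolding Z_def by (rule integrable_power2_real_cond_exp[OF F Y sqY])
  have intZ: "integrable M Z" by (rule square_integrable_imp_integrable[OF Z sqZ])
  have tower: "AE x in M. real_cond_exp M H Z x = real_cond_exp M H Y x"
    if "subalgebra F H" for H
    unfolding Z_def
    by (rule sigma_finite_subalgebra.real_cond_exp_nested_subalg
        [OF sigma_finite_subalgebraI[OF subalgebra_trans[OF F that]] F that intY])
  have efficient: "efficient_under M N X Y A \<longleftrightarrow> (AE x in M. A x = Z x)"
    by (simp add: efficient_under_def cond_exp_given_def Z_def F_def)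
  have calibrated: "calibrated M Y A \<longleftrightarrow> (AE x in M. A x = real_cond_exp M G Y x)"
    by (simp add: calibrated_def G_def)
  show ?thesis
  proof (intro iffI conjI)
    assume "efficient_under M N X Y A"
    then have AZ: "AE x in M. A x = Z x" by (simp add: efficient)
    interpret G: sigma_finite_subalgebra M G by (rule sigma_finite_subalgebraI[OF G])
    \<comment> \<open>No moment of \<open>A\<close> is assumed; integrability is inherited from
      \<open>Z\<close>.\<close>
    have "integrable M A"
      using integrable_cong_AE[of A M Z] AZ intZ by simp
    then have "AE x in M. real_cond_exp M G A x = A x"
      using AG by (rule G.real_cond_exp_F_meas)
    moreover have "AE x in M. real_cond_exp M G A x = real_cond_exp M G Z x"
      by (rule G.real_cond_exp_cong[OF AZ]) auto
    ultimately show "calibrated M Y A"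
      unfolding calibrated using tower[OF GF] by eventually_elim simp
    show "extremizing M N X Y A"
      unfolding extremizing_def
    proof (intro allI impI)
      fix v assume "v \<subseteq> {1..N}"
      then have H: "subalgebra F (sigma_of M X v)"
        unfolding F_def by (rule subalgebra_sigma_of_mono)
      have "variance (cond_exp_given M X v Y) = variance (real_cond_exp M (sigma_of M X v) Z)"
        unfolding cond_exp_given_def
        by (rule variance_cong_AE) (use tower[OF H] in auto)
      also have "\<dots> \<le> variance Z"
        by (rule variance_real_cond_exp_le[OF subalgebra_trans[OF F H] Z sqZ])
      also have "\<dots> = variance A"
        by (rule variance_cong_AE) (use AZ in auto)
      finally show "variance (cond_exp_given M X v Y) \<le> variance A" .
    qed
  next
    assume *: "calibrated M Y A \<and> extremizing M N X Y A"
    \<comment> \<open>Calibration speaks of \<open>Y\<close>; the tower property turns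
      \<open>A\<close> into a projection of \<open>Z\<close>.\<close>
    then have AZ: "AE x in M. A x = real_cond_exp M G Z x"
      using tower[OF GF] unfolding calibrated by auto
    have "variance Z \<le> variance A"
      using * by (auto simp: extremizing_def cond_exp_given_def Z_def F_def)
    also have "\<dots> = variance (real_cond_exp M G Z)"
      by (rule variance_cong_AE[OF _ _ AZ]) auto
    finally have "AE x in M. Z x = real_cond_exp M G Z x"
      by (rule AE_eq_real_cond_exp[OF G Z sqZ])
    with AZ show "efficient_under M N X Y A"
      unfolding efficient by eventually_elim simp
  qed
qed

theorem theorem2p4:
  fixes N :: nat
    and X :: "nat \<Rightarrow> 'a \<Rightarrow> real"
    and Y A :: "'a \<Rightarrow> real"
  shows "(efficient N X Y A \<longleftrightarrow>
            (\<exists>M. calibrated_predictions M N X Y \<and> aggregator M N X A \<and>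
                 calibrated M Y A \<and> extremizing M N X Y A)) \<and>
         (\<forall>M. calibrated_predictions M N X Y \<and> aggregator M N X A \<longrightarrow>
                (efficient_under M N X Y A \<longleftrightarrow>
                   calibrated M Y A \<and> extremizing M N X Y A))"
  \<comment> \<open>The space that witnesses one existential also witnesses the other.\<close>
  unfolding efficient_def using efficient_under_iff by blast

end
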